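(* Let $N\ge1$, $1<p<\infty$ and $0<s<1$ satisfy $sp<N$, and let $p_s^*=\frac{Np}{N-sp}$. For any $q\in[p,p_s^*]$, there exists a constant $C=C(N,s,p,q)>0$ such that, for every $u\in W^{s+\log,p}(\mathbb{R}^N)$, $$\|u\|_{L^q(\mathbb{R}^N)}\le C\,\|u\|^\theta_{W^{s+\log,p}(\mathbb{R}^N)}\,\|u\|^{1-\theta}_{L^p(\mathbb{R}^N)},$$ where $\theta\in[0,1]$ is uniquely determined by $$\frac1q=\frac{1-\theta}{p}+\frac{\theta}{p_s^*}.$$
   Context: $W^{s+\log,p}(\mathbb{R}^N)$ is the space of real-valued $u\in L^p(\mathbb{R}^N)$ with $[u]_{s+\log,p}<\infty$, where $$[u]^p_{s+\log,p}=\iint_{\mathbb{R}^{2N}}|u(x)-u(y)|^p\,\mathbf{k}^{s+\log,+}_p(x-y)\,dx\,dy,\qquad\mathbf{k}^{s+\log,+}_p(z)=\frac{C(N,s,p)(-\ln|z|)_+}{|z|^{N+sp}},$$ $(a)_+=\max\{0,a\}$, with norm $\|u\|^p_{W^{s+\log,p}(\mathbb{R}^N)}=\|u\|^p_{L^p(\mathbb{R}^N)}+[u]^p_{s+\log,p}$, and $$C(N,s,p)=\begin{cases}\dfrac{s\,p\,2^{2(s-1)}\,\Gamma\left(\frac{N+sp}{2}\right)}{\pi^{\frac{N-1}{2}}\,\Gamma(1-s)\,\Gamma\left(\frac{p+1}{2}\right)}, & s>\tfrac12,\\[8pt]\dfrac{s\,p\,2^{2s-1}\,\Gamma\left(\frac{N+sp}{2}\right)}{\pi^{\frac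 N2}\,\Gamma(1-s)}, & s\le\tfrac12.\end{cases}$$ *)

theory Defs
  imports "HOL-Analysis.Analysis"
begin

definition Lp_space :: "real \<Rightarrow> (real ^ 'n \<Rightarrow> real) set" where
  "Lp_space p =
     {u. u \<in> borel_measurable lebesgue \<and> integrable lebesgue (\<lambda>x. \<bar>u x\<bar> powr p)}"

text \<open>Outside \<open>Lp_space p\<close> the Bochner integral, and hence this value, may be a junk \<open>0\<close>;
  the norm is only meaningful together with membership in the space.\<close>

definition Lp_norm :: "real \<Rightarrow> (real ^ 'n \<Rightarrow> real) \<Rightarrow> real" where
  "Lp_norm p u = (integral\<^sup>L lebesgue (\<lambda>x. \<bar>u x\<bar> powr p)) powr (1 / p)"

definition slog_const :: "nat \<Rightarrow> real \<Rightarrow> real \<Rightarrow> real" where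
  "slog_const N s p =
     (if s > 1 / 2
      then s * p * 2 powr (2 * (s - 1)) * Gamma ((real N + s * p) / 2)
             / (pi powr ((real N - 1) / 2) * Gamma (1 - s) * Gamma ((p + 1) / 2))
      else s * p * 2 powr (2 * s - 1) * Gamma ((real N + s * p) / 2)
             / (pi powr (real N / 2) * Gamma (1 - s)))"

text \<open>At \<open>z = 0\<close>, where the mathematical kernel is singular, this takes the value \<open>0\<close>.
  In the double integral below this only concerns the diagonal, a null set.\<close>

definition slog_kernel :: "real \<Rightarrow> real \<Rightarrow> real ^ 'n \<Rightarrow> real" where
  "slog_kernel s p z =
     slog_const CARD('n) s p * max 0 (- ln (norm z)) / norm z powr (real CARD('n) + s * p)"

text \<open>The \<open>p\<close>-th power of the seminorm, with value \<open>\<infinity>\<close> allowed.\<close>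

definition slog_energy :: "real \<Rightarrow> real \<Rightarrow> (real ^ 'n \<Rightarrow> real) \<Rightarrow> ennreal" where
  "slog_energy s p u =
     (\<integral>\<^sup>+ (x, y). ennreal (\<bar>u x - u y\<bar> powr p * slog_kernel s p (x - y))
        \<partial>(lebesgue \<Otimes>\<^sub>M lebesgue))"

definition slog_space :: "real \<Rightarrow> real \<Rightarrow> (real ^ 'n \<Rightarrow> real) set" where
  "slog_space s p = {u \<in> Lp_space p. slog_energy s p u < \<infinity>}"

definition slog_norm :: "real \<Rightarrow> real \<Rightarrow> (real ^ 'n \<Rightarrow> real) \<Rightarrow> real" where
  "slog_norm s p u = (Lp_norm p u powr p + enn2real (slog_energy s p u)) powr (1 / p)"

definition sobolev_exponent :: "nat \<Rightarrow> real \<Rightarrow> real \<Rightarrow> real" where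
  "sobolev_exponent N s p = real N * p / (real N - s * p)"

end

theory Submission
  imports Defs
begin

text \<open>
  Near the origin the logarithmic kernel dominates the kernel of the fractional Sobolev space: where
  \<open>norm z \<le> exp (-1)\<close> the logarithmic factor is at least \<open>1\<close>, so the kernel is bounded below by a
  multiple of \<open>norm z powr -(N + s * p)\<close>.  This reduces the critical exponent
  \<open>P\<close> to a fractional Sobolev inequality for kernels that are singular at \<open>0\<close> but may vanish away
  from it; the exponents between \<open>p\<close> and \<open>P\<close> follow by interpolation of Lebesgue norms.

  The critical inequality rests on a pointwise bound.  Write \<open>I\<close> for the integral of
  \<open>\<bar>v\<bar> powr P\<close>, let \<open>a = \<bar>v x\<bar>\<close>, and choose the radius \<open>r\<close> so that the ball around \<open>x\<close> has volume
  \<open>2 * I * (a / 2) powr (-P)\<close>.  By the Markov inequality \<open>\<bar>v\<bar> < a / 2\<close> on at least half of that ball, and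
  there \<open>\<bar>v x - v y\<bar> \<ge> a / 2\<close>.  If the kernel is large on the ball, the inner energy integral
  \<open>F x\<close> is therefore at least a multiple of \<open>a powr p * r powr -\<sigma>\<close>, where \<open>\<sigma> = s * p\<close>;
  if the ball is too big for that,
  \<open>a powr p * r powr -\<sigma>\<close> is at most a multiple of \<open>a powr p\<close> itself.  The choice of \<open>r\<close> turns
  \<open>a powr p * r powr -\<sigma>\<close> into a multiple of \<open>a powr P * I powr -(\<sigma> / N)\<close>, so that in both cases
  \<open>a powr P\<close> is at most a multiple of \<open>I powr (\<sigma> / N) * (F x + a powr p)\<close>
  (\<open>pointwise_power_bound\<close>).

  Integration over \<open>x\<close> bounds \<open>I\<close> by a multiple of \<open>I powr (\<sigma> / N)\<close> times the \<open>p\<close>-th power of the full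
  norm.  If \<open>I\<close> is finite, dividing by \<open>I powr (\<sigma> / N)\<close> gives the inequality, because
  \<open>1 - \<sigma> / N = p / P\<close> (\<open>sobolev_inequality_finite_norm\<close>).  Finiteness holds for the truncations of
  \<open>v\<close> at height \<open>n\<close>, whose norm and energy are no larger, and monotone convergence removes the
  truncation (\<open>sobolev_inequality\<close>).
\<close>

section \<open>The pointwise bound\<close>

text \<open>
  The Markov inequality bounds the volume of the set where \<open>\<bar>v\<bar> \<ge> t\<close>; a ball with at least twice
  that volume keeps half of itself outside the set.
\<close>

lemma measure_sublevel_ball_ge_half:
  fixes v :: "'a::euclidean_space \<Rightarrow> real"
  assumes [measurable]: "v \<in> borel_measurable lebesgue"
    and int: "integrable lebesgue (\<lambda>y. \<bar>v y\<bar> powr P)" and "0 < P" "0 < t"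
    and small: "2 * integral\<^sup>L lebesgue (\<lambda>y. \<bar>v y\<bar> powr P) \<le> t powr P * measure lebesgue (ball x r)"
  shows "measure lebesgue (ball x r) / 2 \<le> measure lebesgue {y \<in> ball x r. \<bar>v y\<bar> < t}"
proof -
  define H where "H = {y. \<bar>v y\<bar> powr P \<ge> t powr P}"
  have H: "H = {y \<in> space lebesgue. \<bar>v y\<bar> powr P \<ge> t powr P}" by (simp add: H_def)
  have [measurable]: "H \<in> sets lebesgue" unfolding H by measurable
  have tP: "t powr P > 0" using assms by simp
  have em: "emeasure lebesgue H \<le> ennreal ((1 / t powr P) * integral\<^sup>L lebesgue (\<lambda>y. \<bar>v y\<bar> powr P))"
    unfolding H by (rule integral_Markov_inequality[OF int _ tP]) simp
  then have "H \<in> fmeasurable lebesgue"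
    by (intro fmeasurableI) (auto simp: less_top[symmetric] top_unique simp del: emeasure_completion)
  have mH: "measure lebesgue H \<le> integral\<^sup>L lebesgue (\<lambda>y. \<bar>v y\<bar> powr P) / t powr P"
    unfolding H by (rule integral_Markov_inequality_measure[OF int, of "{}"]) (use tP in auto)
  also have "\<dots> \<le> measure lebesgue (ball x r) / 2"
    using small tP by (simp add: field_simps)
  finally have mH2: "measure lebesgue H \<le> measure lebesgue (ball x r) / 2" .
  have iff: "\<bar>v y\<bar> < t \<longleftrightarrow> \<bar>v y\<bar> powr P < t powr P" for y
    using \<open>0 < P\<close> \<open>0 < t\<close> powr_less_mono2[of P "\<bar>v y\<bar>" t] powr_mono2[of P t "\<bar>v y\<bar>"]
    by (cases "\<bar>v y\<bar> < t") auto
  have eq: "{y \<in> ball x r. \<bar>v y\<bar> < t} = ball x r - H"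
    unfolding H_def by (simp only: iff set_diff_eq mem_Collect_eq not_le)
  have B: "ball x r \<in> sets lebesgue" by simp
  have "measure lebesgue (ball x r) = measure lebesgue ((ball x r - H) \<union> (ball x r \<inter> H))"
    by (rule arg_cong[where f = "measure lebesgue"]) blast
  also have "\<dots> \<le> measure lebesgue (ball x r - H) + measure lebesgue (ball x r \<inter> H)"
    by (intro measure_Un_le sets.Int sets.Diff B \<open>H \<in> sets lebesgue\<close>)
  also have "measure lebesgue (ball x r \<inter> H) \<le> measure lebesgue H"
    by (rule measure_mono_fmeasurable[OF _ sets.Int[OF B \<open>H \<in> sets lebesgue\<close>] \<open>H \<in> fmeasurable lebesgue\<close>])
       blast
  finally show ?thesis using mH2 unfolding eq by linarith
qed

text \<open>
  The factor \<open>I powr (\<sigma> / N)\<close> on the right has an exponent below \<open>1\<close>; this is what allows the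
  integrated inequality to be solved for \<open>I\<close>.  The summand \<open>\<bar>v x\<bar> powr p\<close> pays for the points at which
  the selected ball has radius larger than \<open>\<rho>\<close>, beyond which the kernel may be zero.
\<close>

lemma pointwise_power_bound:
  fixes \<kappa> :: "'a::euclidean_space \<Rightarrow> real"
  assumes N: "N = real DIM('a)" and "0 < \<sigma>" "\<sigma> < N" "0 < p" and P: "P = N * p / (N - \<sigma>)"
    and "0 < c" "0 < \<rho>"
    and \<kappa>: "\<And>z. 0 < norm z \<Longrightarrow> norm z \<le> \<rho> \<Longrightarrow> c / norm z powr (N + \<sigma>) \<le> \<kappa> z"
  shows "\<exists>K>0. \<forall>v x. v \<in> borel_measurable lebesgue \<longrightarrow> integrable lebesgue (\<lambda>y. \<bar>v y\<bar> powr P) \<longrightarrow>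
    0 < integral\<^sup>L lebesgue (\<lambda>y. \<bar>v y\<bar> powr P) \<longrightarrow>
    ennreal (\<bar>v x\<bar> powr P) \<le> ennreal (K * integral\<^sup>L lebesgue (\<lambda>y. \<bar>v y\<bar> powr P) powr (\<sigma> / N)) *
      ((\<integral>\<^sup>+y. ennreal (\<bar>v x - v y\<bar> powr p * \<kappa> (x - y)) \<partial>lebesgue) + ennreal (\<bar>v x\<bar> powr p))"
proof -
  have "0 < N" using assms by linarith
  have P_pos: "0 < P" using assms by simp
  have P_eq: "P = p + P * (\<sigma> / N)" using \<open>0 < N\<close> assms by (simp add: field_simps)
  define \<omega> where "\<omega> = unit_ball_vol N"
  have \<omega>: "0 < \<omega>" using \<open>0 < N\<close> by (simp add: \<omega>_def)
  define L where "L = (2 powr (P + 1) / \<omega>) powr (\<sigma> / N)"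
  define D where "D = max (2 powr (p + 1) / (c * \<omega>)) (\<rho> powr (-\<sigma>))"
  have L: "0 < L" using \<omega> by (simp add: L_def)
  have D: "0 < D" using assms \<omega> by (simp add: D_def less_max_iff_disj)
  have D1: "2 powr (p + 1) / (c * \<omega>) \<le> D" and D2: "\<rho> powr (-\<sigma>) \<le> D" by (auto simp: D_def)
  show ?thesis
  proof (intro exI[of _ "L * D"] conjI allI impI)
    show "0 < L * D" using L D by simp
    fix v :: "'a \<Rightarrow> real" and x
    assume v [measurable]: "v \<in> borel_measurable lebesgue"
      and int: "integrable lebesgue (\<lambda>y. \<bar>v y\<bar> powr P)"
    define I where "I = integral\<^sup>L lebesgue (\<lambda>y. \<bar>v y\<bar> powr P)"
    define F where "F = (\<integral>\<^sup>+y. ennreal (\<bar>v x - v y\<bar> powr p * \<kappa> (x - y)) \<partial>lebesgue)"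
    define a where "a = \<bar>v x\<bar>"
    assume "0 < integral\<^sup>L lebesgue (\<lambda>y. \<bar>v y\<bar> powr P)"
    then have I: "0 < I" by (simp add: I_def)
    have "ennreal (a powr P) \<le> ennreal (L * D * I powr (\<sigma> / N)) * (F + ennreal (a powr p))"
    proof (cases "a = 0")
      case False
      then have a: "0 < a" by (simp add: a_def)
      (* The ball of radius r has volume 2 * I / (a / 2) powr P, twice the Markov bound for the
         volume of the set where the modulus of v is at least a / 2. *)
      define r where "r = (2 * I / ((a / 2) powr P * \<omega>)) powr (1 / N)"
      have r: "0 < r" using I a \<omega> by (simp add: r_def)
      have rN: "r powr N = 2 * I / ((a / 2) powr P * \<omega>)"
        using I a \<omega> \<open>0 < N\<close> by (simp add: r_def powr_powr)
      have r\<sigma>: "r powr \<sigma> = L * I powr (\<sigma> / N) * a powr (- (P * (\<sigma> / N)))"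
      proof -
        have "2 * I / ((a / 2) powr P * \<omega>) = (2 powr (P + 1) / \<omega>) * I * a powr (-P)"
          using a by (simp add: powr_divide powr_add powr_minus field_simps)
        then have "r = ((2 powr (P + 1) / \<omega>) * I * a powr (-P)) powr (1 / N)"
          by (simp add: r_def)
        then have "r powr \<sigma> = ((2 powr (P + 1) / \<omega>) * I * a powr (-P)) powr (\<sigma> / N)"
          by (simp add: powr_powr)
        also have "\<dots> = L * I powr (\<sigma> / N) * (a powr (-P)) powr (\<sigma> / N)"
          using I \<omega> a unfolding L_def by (simp only: powr_mult)
        finally show ?thesis by (simp add: powr_powr)
      qed
      have aP: "a powr P = L * I powr (\<sigma> / N) * (a powr p * r powr (-\<sigma>))"
      proof -
        have "a powr P = a powr p * a powr (P * (\<sigma> / N))"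
          by (subst P_eq) (simp add: powr_add)
        moreover have "L * I powr (\<sigma> / N) * r powr (-\<sigma>) = a powr (P * (\<sigma> / N))"
          using L I a unfolding powr_minus r\<sigma> by (simp add: field_simps)
        ultimately show ?thesis by (metis mult.assoc mult.commute)
      qed
      (* A small ball is controlled by the energy at x, a large one by the value at x. *)
      have key: "ennreal (a powr p * r powr (-\<sigma>)) \<le> ennreal D * (F + ennreal (a powr p))"
      proof (cases "r \<le> \<rho>")
        case True
        define G where "G = {y \<in> ball x r. \<bar>v y\<bar> < a / 2}"
        have [measurable]: "G \<in> sets lebesgue"
        proof -
          have "G = ball x r \<inter> {y \<in> space lebesgue. \<bar>v y\<bar> < a / 2}" by (auto simp: G_def)
          also have "\<dots> \<in> sets lebesgue"
            by (intro sets.Int) (simp, measurable)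
          finally show ?thesis .
        qed
        have ball: "measure lebesgue (ball x r) = \<omega> * r powr N"
          using r by (simp add: content_ball \<omega>_def N powr_realpow)
        have "measure lebesgue (ball x r) / 2 \<le> measure lebesgue G"
          unfolding G_def
          by (rule measure_sublevel_ball_ge_half[OF v int P_pos])
             (use a \<omega> in \<open>auto simp: ball rN I_def[symmetric]\<close>)
        then have mG: "\<omega> * r powr N / 2 \<le> measure lebesgue G" by (simp only: ball)
        have fmG: "emeasure lebesgue G = ennreal (measure lebesgue G)"
        proof -
          have "G \<subseteq> ball x r" by (auto simp: G_def)
          then have "G \<in> fmeasurable lebesgue"
            by (rule fmeasurableI2[OF lmeasurable_ball _ \<open>G \<in> sets lebesgue\<close>])
          then show ?thesis by (rule emeasure_eq_measure2)
        qed
        (* h is a lower bound for the energy integrand on G: the difference of the values is at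
           least a / 2 there, and the kernel is at least its lower bound at distance r. *)
        define h where "h = (a / 2) powr p * (c / r powr (N + \<sigma>))"
        have h: "0 \<le> h" using \<open>0 < c\<close> by (simp add: h_def)
        have "ennreal (h * measure lebesgue G) = (\<integral>\<^sup>+y. ennreal h * indicator G y \<partial>lebesgue)"
          using h by (simp add: nn_integral_cmult_indicator fmG ennreal_mult del: emeasure_completion measure_completion)
        also have "\<dots> \<le> F"
          unfolding F_def
        proof (rule nn_integral_mono)
          fix y
          show "ennreal h * indicator G y \<le> ennreal (\<bar>v x - v y\<bar> powr p * \<kappa> (x - y))"
          proof (cases "y \<in> G")
            case True
            then have d: "norm (x - y) < r" and vy: "\<bar>v y\<bar> < a / 2" by (auto simp: G_def dist_norm)
            have "y \<noteq> x" using vy a by (auto simp: a_def)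
            then have n: "0 < norm (x - y)" by simp
            have "c / r powr (N + \<sigma>) \<le> c / norm (x - y) powr (N + \<sigma>)"
              using d n r assms by (intro divide_left_mono powr_mono2) auto
            also have "\<dots> \<le> \<kappa> (x - y)" using n d \<open>r \<le> \<rho>\<close> by (intro \<kappa>) auto
            finally have "c / r powr (N + \<sigma>) \<le> \<kappa> (x - y)" .
            moreover have "(a / 2) powr p \<le> \<bar>v x - v y\<bar> powr p"
              using vy abs_triangle_ineq2[of "v x" "v y"] \<open>0 < p\<close> a unfolding a_def
              by (intro powr_mono2) linarith+
            ultimately have "h \<le> \<bar>v x - v y\<bar> powr p * \<kappa> (x - y)"
              unfolding h_def using \<open>0 < c\<close> by (intro mult_mono) auto
            then show ?thesis using True by (simp add: ennreal_leI)
          qed simp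
        qed
        finally have hF: "ennreal (h * measure lebesgue G) \<le> F" .
        have "a powr p * r powr (-\<sigma>) = 2 powr (p + 1) / (c * \<omega>) * (h * (\<omega> * r powr N / 2))"
          using a r \<omega> \<open>0 < c\<close>
          by (simp add: h_def powr_divide powr_add powr_minus field_simps)
        also have "\<dots> \<le> D * (h * measure lebesgue G)"
          using D1 D h mG \<omega> by (intro mult_mono) auto
        finally have "ennreal (a powr p * r powr (-\<sigma>)) \<le> ennreal D * ennreal (h * measure lebesgue G)"
          using D h by (simp add: ennreal_mult[symmetric] ennreal_leI del: measure_completion)
        also have "\<dots> \<le> ennreal D * (F + ennreal (a powr p))"
          using hF by (intro mult_left_mono) (auto intro: add_increasing2)
        finally show ?thesis .
      next
        case False
        then have "r powr (-\<sigma>) \<le> \<rho> powr (-\<sigma>)"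
          using assms by (intro powr_mono2') auto
        then have "a powr p * r powr (-\<sigma>) \<le> D * a powr p"
          using D2 by (subst mult.commute) (intro mult_right_mono, auto)
        then have "ennreal (a powr p * r powr (-\<sigma>)) \<le> ennreal D * ennreal (a powr p)"
          using D by (simp add: ennreal_mult[symmetric] ennreal_leI)
        also have "\<dots> \<le> ennreal D * (F + ennreal (a powr p))"
          by (intro mult_left_mono) (auto intro: add_increasing)
        finally show ?thesis .
      qed
      have "ennreal (a powr P) = ennreal (L * I powr (\<sigma> / N)) * ennreal (a powr p * r powr (-\<sigma>))"
        unfolding aP using L by (intro ennreal_mult) auto
      also have "\<dots> \<le> ennreal (L * I powr (\<sigma> / N)) * (ennreal D * (F + ennreal (a powr p)))"
        using key by (rule mult_left_mono) simp
      also have "\<dots> = ennreal (L * D * I powr (\<sigma> / N)) * (F + ennreal (a powr p))"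
        using L D by (simp add: ennreal_mult mult_ac)
      finally show ?thesis .
    qed simp
    then show "ennreal (\<bar>v x\<bar> powr P) \<le> ennreal (L * D * integral\<^sup>L lebesgue (\<lambda>y. \<bar>v y\<bar> powr P) powr (\<sigma> / N)) *
      ((\<integral>\<^sup>+y. ennreal (\<bar>v x - v y\<bar> powr p * \<kappa> (x - y)) \<partial>lebesgue) + ennreal (\<bar>v x\<bar> powr p))"
      by (simp add: a_def I_def F_def)
  qed
qed

section \<open>The Sobolev inequality for singular kernels\<close>

definition kernel_energy :: "('a::euclidean_space \<Rightarrow> real) \<Rightarrow> real \<Rightarrow> ('a \<Rightarrow> real) \<Rightarrow> ennreal" where
  "kernel_energy \<kappa> p v =
     (\<integral>\<^sup>+ (x, y). ennreal (\<bar>v x - v y\<bar> powr p * \<kappa> (x - y)) \<partial>(lebesgue \<Otimes>\<^sub>M lebesgue))"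

lemma sigma_finite_lebesgue: "sigma_finite_measure (lebesgue :: 'a::euclidean_space measure)"
proof
  show "\<exists>A. countable A \<and> A \<subseteq> sets lebesgue \<and> \<Union> A = space (lebesgue :: 'a measure) \<and>
      (\<forall>a\<in>A. emeasure lebesgue a \<noteq> \<infinity>)"
  proof (intro exI conjI ballI)
    show "countable (range (\<lambda>n::nat. ball (0::'a) (real n)))" by simp
    show "range (\<lambda>n::nat. ball (0::'a) (real n)) \<subseteq> sets lebesgue" by auto
    show "\<Union> (range (\<lambda>n::nat. ball (0::'a) (real n))) = space lebesgue"
      using reals_Archimedean2 by auto
    show "emeasure lebesgue a \<noteq> \<infinity>" if "a \<in> range (\<lambda>n::nat. ball (0::'a) (real n))" for a
      using that fmeasurableD2[OF lmeasurable_ball] by (auto simp del: emeasure_completion)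
  qed
qed

text \<open>
  The sigma-algebra here is the product of two completed ones, not its completion.  The kernel is
  measurable for it because \<open>\<kappa>\<close> is Borel and the identity is measurable from Lebesgue to Borel sets;
  \<open>v\<close>, which is only Lebesgue measurable, is composed with a projection alone.
\<close>

lemma measurable_kernel_integrand:
  fixes v :: "'a::euclidean_space \<Rightarrow> real"
  assumes [measurable]: "v \<in> borel_measurable lebesgue" "\<kappa> \<in> borel_measurable borel"
  shows "(\<lambda>(x, y). ennreal (\<bar>v x - v y\<bar> powr p * \<kappa> (x - y)))
    \<in> borel_measurable (lebesgue \<Otimes>\<^sub>M lebesgue)"
proof -
  have id [measurable]: "(\<lambda>x::'a. x) \<in> borel_measurable lebesgue"
    by (simp add: measurable_completion)
  have [measurable]: "fst \<in> borel_measurable ((lebesgue :: 'a measure) \<Otimes>\<^sub>M (lebesgue :: 'a measure))"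
      "snd \<in> borel_measurable ((lebesgue :: 'a measure) \<Otimes>\<^sub>M (lebesgue :: 'a measure))"
    using measurable_compose[OF measurable_fst id] measurable_compose[OF measurable_snd id] by simp_all
  have [measurable]: "(\<lambda>z. \<kappa> (fst z - snd z)) \<in> borel_measurable (lebesgue \<Otimes>\<^sub>M (lebesgue :: 'a measure))"
    by (rule measurable_compose[OF _ assms(2)]) measurable
  have [measurable]: "(\<lambda>z. v (fst z)) \<in> borel_measurable ((lebesgue :: 'a measure) \<Otimes>\<^sub>M (lebesgue :: 'a measure))"
     "(\<lambda>z. v (snd z)) \<in> borel_measurable ((lebesgue :: 'a measure) \<Otimes>\<^sub>M (lebesgue :: 'a measure))"
    using measurable_compose[OF measurable_fst assms(1)] measurable_compose[OF measurable_snd assms(1)] by simp_all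
  show ?thesis unfolding split_beta by measurable
qed

text \<open>
  Integrating the pointwise bound gives \<open>I \<le> K * I powr (\<sigma> / N) * (A + e)\<close>, with \<open>A\<close> the integral of
  \<open>\<bar>v\<bar> powr p\<close> and \<open>e\<close> the energy.  Dividing by \<open>I powr (\<sigma> / N)\<close> needs \<open>I\<close> finite, hence the
  integrability hypothesis at the exponent \<open>P\<close>.
\<close>

lemma sobolev_inequality_finite_norm:
  fixes \<kappa> :: "'a::euclidean_space \<Rightarrow> real"
  assumes N: "N = real DIM('a)" and "0 < \<sigma>" "\<sigma> < N" "0 < p" and P: "P = N * p / (N - \<sigma>)"
    and "0 < c" "0 < \<rho>"
    and \<kappa>: "\<And>z. 0 < norm z \<Longrightarrow> norm z \<le> \<rho> \<Longrightarrow> c / norm z powr (N + \<sigma>) \<le> \<kappa> z"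
    and \<kappa>_meas: "\<kappa> \<in> borel_measurable borel"
  shows "\<exists>K>0. \<forall>v. v \<in> borel_measurable lebesgue \<longrightarrow> integrable lebesgue (\<lambda>y. \<bar>v y\<bar> powr P) \<longrightarrow>
    integrable lebesgue (\<lambda>y. \<bar>v y\<bar> powr p) \<longrightarrow> kernel_energy \<kappa> p v < \<infinity> \<longrightarrow>
    integral\<^sup>L lebesgue (\<lambda>y. \<bar>v y\<bar> powr P)
      \<le> (K * (integral\<^sup>L lebesgue (\<lambda>y. \<bar>v y\<bar> powr p) + enn2real (kernel_energy \<kappa> p v))) powr (P / p)"
proof -
  obtain K where K: "0 < K" and bound: "\<And>v x. v \<in> borel_measurable lebesgue \<Longrightarrow>
    integrable lebesgue (\<lambda>y. \<bar>v y\<bar> powr P) \<Longrightarrow>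
    0 < integral\<^sup>L lebesgue (\<lambda>y. \<bar>v y\<bar> powr P) \<Longrightarrow>
    ennreal (\<bar>v x\<bar> powr P) \<le> ennreal (K * integral\<^sup>L lebesgue (\<lambda>y. \<bar>v y\<bar> powr P) powr (\<sigma> / N)) *
      ((\<integral>\<^sup>+y. ennreal (\<bar>v x - v y\<bar> powr p * \<kappa> (x - y)) \<partial>lebesgue) + ennreal (\<bar>v x\<bar> powr p))"
    using pointwise_power_bound[OF assms(1-8)] by blast
  show ?thesis
  proof (intro exI[of _ K] conjI allI impI K)
    fix v :: "'a \<Rightarrow> real"
    assume v [measurable]: "v \<in> borel_measurable lebesgue"
      and intP: "integrable lebesgue (\<lambda>y. \<bar>v y\<bar> powr P)"
      and intp: "integrable lebesgue (\<lambda>y. \<bar>v y\<bar> powr p)"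
      and fin: "kernel_energy \<kappa> p v < \<infinity>"
    define I where "I = integral\<^sup>L lebesgue (\<lambda>y. \<bar>v y\<bar> powr P)"
    define A where "A = integral\<^sup>L lebesgue (\<lambda>y. \<bar>v y\<bar> powr p)"
    define e where "e = enn2real (kernel_energy \<kappa> p v)"
    define F where "F x = (\<integral>\<^sup>+y. ennreal (\<bar>v x - v y\<bar> powr p * \<kappa> (x - y)) \<partial>lebesgue)" for x
    have A: "0 \<le> A" by (simp add: A_def)
    have e: "0 \<le> e" by (simp add: e_def)
    interpret L: sigma_finite_measure "lebesgue :: 'a measure" by (rule sigma_finite_lebesgue)
    have F_meas [measurable]: "F \<in> borel_measurable lebesgue"
      using L.borel_measurable_nn_integral_fst[OF measurable_kernel_integrand[OF v \<kappa>_meas, of p]]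
      by (simp add: F_def[abs_def])
    have F_int: "(\<integral>\<^sup>+x. F x \<partial>lebesgue) = ennreal e"
      using L.nn_integral_fst[OF measurable_kernel_integrand[OF v \<kappa>_meas, of p]] fin
      by (simp add: F_def e_def kernel_energy_def)
    have "I \<le> (K * (A + e)) powr (P / p)"
    proof (cases "I = 0")
      case False
      have "0 \<le> I" by (simp add: I_def)
      with False have I: "0 < I" by simp
      have "ennreal I = (\<integral>\<^sup>+x. ennreal (\<bar>v x\<bar> powr P) \<partial>lebesgue)"
        unfolding I_def by (rule nn_integral_eq_integral[OF intP, symmetric]) simp
      also have "\<dots> \<le> (\<integral>\<^sup>+x. ennreal (K * I powr (\<sigma> / N)) * (F x + ennreal (\<bar>v x\<bar> powr p)) \<partial>lebesgue)"
        unfolding F_def I_def by (rule nn_integral_mono) (use bound[OF v intP] I in \<open>simp add: I_def\<close>)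
      also have "\<dots> = ennreal (K * I powr (\<sigma> / N)) * (\<integral>\<^sup>+x. F x + ennreal (\<bar>v x\<bar> powr p) \<partial>lebesgue)"
        by (rule nn_integral_cmult) measurable
      also have "(\<integral>\<^sup>+x. F x + ennreal (\<bar>v x\<bar> powr p) \<partial>lebesgue) = ennreal e + ennreal A"
        unfolding F_int[symmetric] A_def nn_integral_eq_integral[OF intp AE_I2[OF powr_ge_zero], symmetric]
        by (rule nn_integral_add) measurable
      finally have "ennreal I \<le> ennreal (K * I powr (\<sigma> / N) * (e + A))"
        using A e K by (simp add: ennreal_mult)
      then have "I \<le> K * I powr (\<sigma> / N) * (e + A)"
        using A e K by (subst (asm) ennreal_le_iff) auto
      then have "I powr (1 - \<sigma> / N) \<le> K * (A + e)"
        using I by (simp add: powr_diff field_simps)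
      moreover have ex: "1 - \<sigma> / N = p / P"
        unfolding P using assms by (simp add: field_simps)
      ultimately have "I powr (p / P) \<le> K * (A + e)" by simp
      then have "(I powr (p / P)) powr (P / p) \<le> (K * (A + e)) powr (P / p)"
        using assms by (intro powr_mono2) auto
      moreover have "p \<noteq> 0" "P \<noteq> 0" using assms by auto
      ultimately show ?thesis using I by (simp add: powr_powr)
    qed simp
    then show "integral\<^sup>L lebesgue (\<lambda>y. \<bar>v y\<bar> powr P)
      \<le> (K * (integral\<^sup>L lebesgue (\<lambda>y. \<bar>v y\<bar> powr p) + enn2real (kernel_energy \<kappa> p v))) powr (P / p)"
      by (simp add: I_def A_def e_def)
  qed
qed

text \<open>
  Clamping \<open>v\<close> to \<open>[-n, n]\<close> is a contraction, so it increases neither the energy nor the integral of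
  \<open>\<bar>v\<bar> powr p\<close>; and the clamped function has an integrable \<open>P\<close>-th power, since
  \<open>\<bar>w\<bar> powr P \<le> n powr (P - p) * \<bar>w\<bar> powr p\<close>.  The bound for the clamped functions is uniform in \<open>n\<close>.
\<close>

lemma sobolev_inequality:
  fixes \<kappa> :: "'a::euclidean_space \<Rightarrow> real"
  assumes N: "N = real DIM('a)" and "0 < \<sigma>" "\<sigma> < N" "0 < p" and P: "P = N * p / (N - \<sigma>)"
    and "0 < c" "0 < \<rho>"
    and \<kappa>: "\<And>z. 0 < norm z \<Longrightarrow> norm z \<le> \<rho> \<Longrightarrow> c / norm z powr (N + \<sigma>) \<le> \<kappa> z"
    and \<kappa>_meas: "\<kappa> \<in> borel_measurable borel" and \<kappa>_nonneg: "\<And>z. 0 \<le> \<kappa> z"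
  shows "\<exists>K>0. \<forall>v. v \<in> borel_measurable lebesgue \<longrightarrow>
    integrable lebesgue (\<lambda>y. \<bar>v y\<bar> powr p) \<longrightarrow> kernel_energy \<kappa> p v < \<infinity> \<longrightarrow>
    integrable lebesgue (\<lambda>y. \<bar>v y\<bar> powr P) \<and>
    integral\<^sup>L lebesgue (\<lambda>y. \<bar>v y\<bar> powr P)
      \<le> (K * (integral\<^sup>L lebesgue (\<lambda>y. \<bar>v y\<bar> powr p) + enn2real (kernel_energy \<kappa> p v))) powr (P / p)"
proof -
  obtain K where K: "0 < K" and bound: "\<And>v. v \<in> borel_measurable lebesgue \<Longrightarrow>
    integrable lebesgue (\<lambda>y. \<bar>v y\<bar> powr P) \<Longrightarrow>
    integrable lebesgue (\<lambda>y. \<bar>v y\<bar> powr p) \<Longrightarrow> kernel_energy \<kappa> p v < \<infinity> \<Longrightarrow>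
    integral\<^sup>L lebesgue (\<lambda>y. \<bar>v y\<bar> powr P)
      \<le> (K * (integral\<^sup>L lebesgue (\<lambda>y. \<bar>v y\<bar> powr p) + enn2real (kernel_energy \<kappa> p v))) powr (P / p)"
    using sobolev_inequality_finite_norm[OF assms(1-9)] by blast
  have "p < P" unfolding P using \<open>0 < \<sigma>\<close> \<open>\<sigma> < N\<close> \<open>0 < p\<close> by (simp add: less_divide_eq algebra_simps)
  show ?thesis
  proof (rule exI[of _ K], rule conjI[OF K], intro allI impI)
    fix v :: "'a \<Rightarrow> real"
    assume v [measurable]: "v \<in> borel_measurable lebesgue"
      and intp: "integrable lebesgue (\<lambda>y. \<bar>v y\<bar> powr p)"
      and fin: "kernel_energy \<kappa> p v < \<infinity>"
    define B where "B = (K * (integral\<^sup>L lebesgue (\<lambda>y. \<bar>v y\<bar> powr p) + enn2real (kernel_energy \<kappa> p v))) powr (P / p)"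
    define w where "w n y = max (- real n) (min (real n) (v y))" for n :: nat and y
    have w_meas [measurable]: "w n \<in> borel_measurable lebesgue" for n
      unfolding w_def by measurable
    have w_abs: "\<bar>w n y\<bar> = min (real n) \<bar>v y\<bar>" for n y
      by (auto simp: w_def)
    have w_bound: "(\<integral>\<^sup>+y. ennreal (\<bar>w n y\<bar> powr P) \<partial>lebesgue) \<le> ennreal B" for n
    proof -
      have wp: "\<bar>w n y\<bar> powr p \<le> \<bar>v y\<bar> powr p" for y
        using \<open>0 < p\<close> by (intro powr_mono2) (auto simp: w_abs)
      have wP: "\<bar>w n y\<bar> powr P \<le> real n powr (P - p) * \<bar>v y\<bar> powr p" for y
      proof -
        have "\<bar>w n y\<bar> powr P = \<bar>w n y\<bar> powr (P - p) * \<bar>w n y\<bar> powr p"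
          by (simp flip: powr_add)
        also have "\<dots> \<le> real n powr (P - p) * \<bar>v y\<bar> powr p"
          using wp \<open>p < P\<close> \<open>0 < p\<close> by (intro mult_mono powr_mono2) (auto simp: w_abs)
        finally show ?thesis .
      qed
      have w_intp: "integrable lebesgue (\<lambda>y. \<bar>w n y\<bar> powr p)"
        by (rule Bochner_Integration.integrable_bound[OF intp]) (use wp in auto)
      have w_intP: "integrable lebesgue (\<lambda>y. \<bar>w n y\<bar> powr P)"
        by (rule Bochner_Integration.integrable_bound[OF integrable_mult_right[OF intp, of "real n powr (P - p)"]])
           (use wP in auto)
      have w_en: "kernel_energy \<kappa> p (w n) \<le> kernel_energy \<kappa> p v"
        unfolding kernel_energy_def split_beta
      proof (rule nn_integral_mono)
        fix z :: "'a \<times> 'a"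
        have "\<bar>w n (fst z) - w n (snd z)\<bar> \<le> \<bar>v (fst z) - v (snd z)\<bar>"
          by (auto simp: w_def)
        then show "ennreal (\<bar>w n (fst z) - w n (snd z)\<bar> powr p * \<kappa> (fst z - snd z))
          \<le> ennreal (\<bar>v (fst z) - v (snd z)\<bar> powr p * \<kappa> (fst z - snd z))"
          using \<open>0 < p\<close> \<kappa>_nonneg by (intro ennreal_leI mult_right_mono powr_mono2) auto
      qed
      have "(\<integral>\<^sup>+y. ennreal (\<bar>w n y\<bar> powr P) \<partial>lebesgue) = ennreal (integral\<^sup>L lebesgue (\<lambda>y. \<bar>w n y\<bar> powr P))"
        by (rule nn_integral_eq_integral[OF w_intP]) simp
      also have "\<dots> \<le> ennreal ((K * (integral\<^sup>L lebesgue (\<lambda>y. \<bar>w n y\<bar> powr p) + enn2real (kernel_energy \<kappa> p (w n)))) powr (P / p))"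
        using w_en fin by (intro ennreal_leI bound w_meas w_intP w_intp) auto
      also have "\<dots> \<le> ennreal B"
        unfolding B_def using K \<open>p < P\<close> \<open>0 < p\<close> fin
        by (intro ennreal_leI powr_mono2 mult_left_mono add_mono integral_mono w_intp intp wp
             enn2real_mono w_en mult_nonneg_nonneg add_nonneg_nonneg integral_nonneg_AE) auto
      finally show ?thesis .
    qed
    have "(\<integral>\<^sup>+y. ennreal (\<bar>v y\<bar> powr P) \<partial>lebesgue) = (\<integral>\<^sup>+y. (SUP n. ennreal (\<bar>w n y\<bar> powr P)) \<partial>lebesgue)"
    proof (rule nn_integral_cong)
      fix y
      obtain m :: nat where m: "\<bar>v y\<bar> \<le> real m" using real_arch_simple by blast
      show "ennreal (\<bar>v y\<bar> powr P) = (SUP n. ennreal (\<bar>w n y\<bar> powr P))"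
      proof (rule antisym)
        have "ennreal (\<bar>v y\<bar> powr P) = ennreal (\<bar>w m y\<bar> powr P)"
          using m by (simp add: w_abs min_def)
        then show "ennreal (\<bar>v y\<bar> powr P) \<le> (SUP n. ennreal (\<bar>w n y\<bar> powr P))"
          using SUP_upper[OF UNIV_I, of "\<lambda>n. ennreal (\<bar>w n y\<bar> powr P)" m] by simp
        show "(SUP n. ennreal (\<bar>w n y\<bar> powr P)) \<le> ennreal (\<bar>v y\<bar> powr P)"
          using \<open>0 < p\<close> \<open>p < P\<close> by (intro SUP_least ennreal_leI powr_mono2) (auto simp: w_abs)
      qed
    qed
    also have "\<dots> = (SUP n. \<integral>\<^sup>+y. ennreal (\<bar>w n y\<bar> powr P) \<partial>lebesgue)"
    proof (rule nn_integral_monotone_convergence_SUP)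
      show "incseq (\<lambda>n y. ennreal (\<bar>w n y\<bar> powr P))"
        using \<open>0 < p\<close> \<open>p < P\<close>
        by (intro monoI le_funI ennreal_leI powr_mono2) (auto simp: w_abs min_def)
    qed measurable
    also have "\<dots> \<le> ennreal B" by (rule SUP_least) (rule w_bound)
    finally have le: "(\<integral>\<^sup>+y. ennreal (\<bar>v y\<bar> powr P) \<partial>lebesgue) \<le> ennreal B" .
    then have int: "integrable lebesgue (\<lambda>y. \<bar>v y\<bar> powr P)"
      by (intro integrableI_nonneg) (auto intro: le_less_trans)
    moreover have "integral\<^sup>L lebesgue (\<lambda>y. \<bar>v y\<bar> powr P) \<le> B"
      using le nn_integral_eq_integral[OF int] by (simp add: B_def)
    ultimately show "integrable lebesgue (\<lambda>y. \<bar>v y\<bar> powr P) \<and>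
      integral\<^sup>L lebesgue (\<lambda>y. \<bar>v y\<bar> powr P)
      \<le> (K * (integral\<^sup>L lebesgue (\<lambda>y. \<bar>v y\<bar> powr p) + enn2real (kernel_energy \<kappa> p v))) powr (P / p)"
      by (simp add: B_def)
  qed
qed

section \<open>Interpolation of Lebesgue norms\<close>

text \<open>
  If both integrals \<open>A\<close> and \<open>B\<close> are positive, this is the pointwise Young inequality for the
  normalised functions \<open>\<bar>u\<bar> powr p / A\<close> and \<open>\<bar>u\<bar> powr r / B\<close>, integrated.  If one of them vanishes, so
  does \<open>u\<close> almost everywhere, and the left-hand side is \<open>0\<close>; the right-hand side is then
  nonnegative whatever \<open>0 powr 0\<close> is.
\<close>

lemma lyapunov_inequality:
  fixes u :: "'a \<Rightarrow> real"
  assumes [measurable]: "u \<in> borel_measurable M"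
    and intp: "integrable M (\<lambda>x. \<bar>u x\<bar> powr p)" and intr: "integrable M (\<lambda>x. \<bar>u x\<bar> powr r)"
    and "0 < p" "0 < r" "0 \<le> \<alpha>" "0 \<le> \<beta>" "\<alpha> + \<beta> = 1" and q: "q = \<alpha> * p + \<beta> * r"
  shows "integrable M (\<lambda>x. \<bar>u x\<bar> powr q)"
    and "integral\<^sup>L M (\<lambda>x. \<bar>u x\<bar> powr q)
      \<le> integral\<^sup>L M (\<lambda>x. \<bar>u x\<bar> powr p) powr \<alpha> * integral\<^sup>L M (\<lambda>x. \<bar>u x\<bar> powr r) powr \<beta>"
proof -
  have young: "\<bar>u x\<bar> powr q \<le> (a powr \<alpha> * b powr \<beta>) * (\<alpha> * (\<bar>u x\<bar> powr p / a) + \<beta> * (\<bar>u x\<bar> powr r / b))"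
    if "0 < a" "0 < b" for a b x
  proof (cases "u x = 0")
    case False
    have "\<bar>u x\<bar> powr q = (\<bar>u x\<bar> powr p) powr \<alpha> * (\<bar>u x\<bar> powr r) powr \<beta>"
      by (simp add: q powr_powr powr_add mult.commute)
    also have "\<dots> = (a powr \<alpha> * b powr \<beta>) * ((\<bar>u x\<bar> powr p / a) powr \<alpha> * (\<bar>u x\<bar> powr r / b) powr \<beta>)"
      using that by (simp add: powr_divide)
    also have "\<dots> \<le> (a powr \<alpha> * b powr \<beta>) * (\<alpha> * (\<bar>u x\<bar> powr p / a) + \<beta> * (\<bar>u x\<bar> powr r / b))"
      using False that assms by (intro mult_left_mono Youngs_inequality_0) auto
    finally show ?thesis .
  qed simp
  show int: "integrable M (\<lambda>x. \<bar>u x\<bar> powr q)"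
  proof (rule Bochner_Integration.integrable_bound)
    show "integrable M (\<lambda>x. \<alpha> * \<bar>u x\<bar> powr p + \<beta> * \<bar>u x\<bar> powr r)"
      using intp intr by simp
    show "AE x in M. norm (\<bar>u x\<bar> powr q) \<le> norm (\<alpha> * \<bar>u x\<bar> powr p + \<beta> * \<bar>u x\<bar> powr r)"
    proof (rule AE_I2)
      fix x
      show "norm (\<bar>u x\<bar> powr q) \<le> norm (\<alpha> * \<bar>u x\<bar> powr p + \<beta> * \<bar>u x\<bar> powr r)"
        (* With a = b = 1 the Young inequality provides an integrable majorant. *)
        using young[of 1 1 x] by simp
    qed
  qed measurable
  define A where "A = integral\<^sup>L M (\<lambda>x. \<bar>u x\<bar> powr p)"
  define B where "B = integral\<^sup>L M (\<lambda>x. \<bar>u x\<bar> powr r)"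
  have nonneg: "0 \<le> A" "0 \<le> B" by (simp_all add: A_def B_def)
  have "integral\<^sup>L M (\<lambda>x. \<bar>u x\<bar> powr q) \<le> A powr \<alpha> * B powr \<beta>"
  proof (cases "A = 0 \<or> B = 0")
    case True
    then have "AE x in M. u x = 0"
      using integral_nonneg_eq_0_iff_AE[OF intp] integral_nonneg_eq_0_iff_AE[OF intr]
      by (auto simp: A_def B_def)
    then have "AE x in M. \<bar>u x\<bar> powr q = 0" by eventually_elim simp
    then have "integral\<^sup>L M (\<lambda>x. \<bar>u x\<bar> powr q) = 0"
      by (rule integral_eq_zero_AE)
    then show ?thesis by simp
  next
    case False
    with nonneg have pos: "0 < A" "0 < B" by auto
    have "integral\<^sup>L M (\<lambda>x. \<bar>u x\<bar> powr q)
      \<le> integral\<^sup>L M (\<lambda>x. (A powr \<alpha> * B powr \<beta>) * (\<alpha> * (\<bar>u x\<bar> powr p / A) + \<beta> * (\<bar>u x\<bar> powr r / B)))"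
      using int intp intr young[OF pos] by (intro integral_mono) auto
    also have "\<dots> = (A powr \<alpha> * B powr \<beta>) * (\<alpha> * (A / A) + \<beta> * (B / B))"
      using intp intr by (simp add: A_def B_def)
    also have "\<dots> = A powr \<alpha> * B powr \<beta>" using pos assms by simp
    finally show ?thesis .
  qed
  then show "integral\<^sup>L M (\<lambda>x. \<bar>u x\<bar> powr q)
      \<le> integral\<^sup>L M (\<lambda>x. \<bar>u x\<bar> powr p) powr \<alpha> * integral\<^sup>L M (\<lambda>x. \<bar>u x\<bar> powr r) powr \<beta>"
    by (simp add: A_def B_def)
qed

text \<open>
  The weights \<open>(1 - \<theta>) * q / p\<close> and \<open>\<theta> * q / r\<close> sum to \<open>1\<close> and average \<open>p\<close> and \<open>r\<close> to \<open>q\<close>; taking the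
  \<open>q\<close>-th root of the Lyapunov inequality leaves the exponents \<open>1 - \<theta>\<close> and \<open>\<theta>\<close> on the norms.
\<close>

lemma Lp_norm_interpolation:
  fixes u :: "real ^ 'n::finite \<Rightarrow> real"
  assumes up: "u \<in> Lp_space p" and ur: "u \<in> Lp_space r" and "0 < p" "0 < r" "0 < q" "\<theta> \<in> {0..1}"
    and q: "1 / q = (1 - \<theta>) / p + \<theta> / r"
  shows "u \<in> Lp_space q \<and> Lp_norm q u \<le> Lp_norm p u powr (1 - \<theta>) * Lp_norm r u powr \<theta>"
proof -
  define \<alpha> where "\<alpha> = (1 - \<theta>) * q / p"
  define \<beta> where "\<beta> = \<theta> * q / r"
  have ab: "0 \<le> \<alpha>" "0 \<le> \<beta>" using assms by (auto simp: \<alpha>_def \<beta>_def)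
  have "\<alpha> + \<beta> = q * ((1 - \<theta>) / p + \<theta> / r)"
    by (simp add: \<alpha>_def \<beta>_def field_simps)
  also have "\<dots> = 1" using \<open>0 < q\<close> by (simp flip: q)
  finally have sum: "\<alpha> + \<beta> = 1" .
  have qe: "q = \<alpha> * p + \<beta> * r"
    using assms by (simp add: \<alpha>_def \<beta>_def field_simps)
  have u: "u \<in> borel_measurable lebesgue" "integrable lebesgue (\<lambda>x. \<bar>u x\<bar> powr p)"
     "integrable lebesgue (\<lambda>x. \<bar>u x\<bar> powr r)"
    using up ur by (auto simp: Lp_space_def)
  note ly = lyapunov_inequality[OF u \<open>0 < p\<close> \<open>0 < r\<close> ab sum qe]
  define A where "A = integral\<^sup>L lebesgue (\<lambda>x. \<bar>u x\<bar> powr p)"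
  define B where "B = integral\<^sup>L lebesgue (\<lambda>x. \<bar>u x\<bar> powr r)"
  have "Lp_norm q u \<le> (A powr \<alpha> * B powr \<beta>) powr (1 / q)"
    unfolding Lp_norm_def A_def B_def using ly(2) \<open>0 < q\<close> by (intro powr_mono2) auto
  also have "\<dots> = Lp_norm p u powr (1 - \<theta>) * Lp_norm r u powr \<theta>"
    using \<open>0 < q\<close> by (simp add: Lp_norm_def A_def B_def powr_mult powr_powr \<alpha>_def \<beta>_def)
  finally show ?thesis using ly(1) u by (simp add: Lp_space_def)
qed

lemma interpolation_parameter_unique:
  fixes p P q :: real
  assumes "0 < p" "p < P" "q \<in> {p..P}"
  shows "\<exists>!\<theta>. \<theta> \<in> {0..1} \<and> 1 / q = (1 - \<theta>) / p + \<theta> / P"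
proof -
  define d where "d = 1 / p - 1 / P"
  have d: "0 < d" using assms by (simp add: d_def field_simps)
  have eq: "1 / q = (1 - \<theta>) / p + \<theta> / P \<longleftrightarrow> \<theta> = (1 / p - 1 / q) / d" for \<theta>
  proof -
    have "(1 - \<theta>) / p + \<theta> / P = 1 / p - \<theta> * d"
      by (simp add: d_def diff_divide_distrib right_diff_distrib)
    then show ?thesis using d by (auto simp: field_simps)
  qed
  have "1 / q \<le> 1 / p" "1 / P \<le> 1 / q" using assms by (auto intro: divide_left_mono)
  then have "(1 / p - 1 / q) / d \<in> {0..1}" using d by (simp add: d_def)
  then show ?thesis unfolding eq by blast
qed

section \<open>The logarithmic kernel\<close>

lemma slog_const_pos:
  assumes "0 < p" "0 < s" "s < 1"
  shows "0 < slog_const N s p"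
  using assms unfolding slog_const_def
  by (auto intro!: divide_pos_pos mult_pos_pos Gamma_real_pos add_nonneg_pos)

lemma slog_kernel_nonneg:
  assumes "0 < p" "0 < s" "s < 1"
  shows "0 \<le> slog_kernel s p z"
  using slog_const_pos[OF assms] by (auto simp: slog_kernel_def less_imp_le intro!: divide_nonneg_nonneg mult_nonneg_nonneg)

text \<open>
  The radius \<open>exp (-1)\<close> is where \<open>- ln (norm z)\<close> reaches \<open>1\<close>.
\<close>

lemma slog_kernel_ge_power:
  fixes z :: "real ^ 'n::finite"
  assumes "0 < p" "0 < s" "s < 1" "0 < norm z" "norm z \<le> exp (-1)"
  shows "slog_const CARD('n) s p / norm z powr (real CARD('n) + s * p) \<le> slog_kernel s p z"
proof -
  have "ln (norm z) \<le> ln (exp (-1))" using assms by (subst ln_le_cancel_iff) auto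
  then have "1 \<le> max 0 (- ln (norm z))" by simp
  then have "slog_const CARD('n) s p * 1 \<le> slog_const CARD('n) s p * max 0 (- ln (norm z))"
    using slog_const_pos[OF assms(1-3), of "CARD('n)"] by (intro mult_left_mono) auto
  then show ?thesis
    unfolding slog_kernel_def by (intro divide_right_mono) auto
qed

lemma slog_energy_eq: "slog_energy s p u = kernel_energy (slog_kernel s p) p u"
  by (simp add: slog_energy_def kernel_energy_def)

text \<open>
  The constant is taken at least \<open>1\<close> so that \<open>C powr \<theta> \<le> C\<close> for every \<open>\<theta>\<close> in \<open>{0..1}\<close>.
\<close>

lemma slog_sobolev_embedding:
  fixes s p :: real
  assumes "1 < p" "0 < s" "s < 1" "s * p < real CARD('n::finite)"
  defines "P \<equiv> sobolev_exponent CARD('n) s p"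
  shows "\<exists>C\<ge>1. \<forall>u :: real ^ 'n \<Rightarrow> real. u \<in> slog_space s p \<longrightarrow>
    u \<in> Lp_space P \<and> Lp_norm P u \<le> C * slog_norm s p u"
proof -
  have P: "P = real CARD('n) * p / (real CARD('n) - s * p)"
    by (simp add: P_def sobolev_exponent_def)
  have "0 < p" "0 < P" using assms(1,4) by (auto simp: P)
  have "slog_kernel s p \<in> borel_measurable (borel :: (real ^ 'n) measure)"
    unfolding slog_kernel_def[abs_def] by measurable
  then have "\<exists>K>0. \<forall>v::real ^ 'n \<Rightarrow> real. v \<in> borel_measurable lebesgue \<longrightarrow>
    integrable lebesgue (\<lambda>y. \<bar>v y\<bar> powr p) \<longrightarrow> kernel_energy (slog_kernel s p) p v < \<infinity> \<longrightarrow>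
    integrable lebesgue (\<lambda>y. \<bar>v y\<bar> powr P) \<and>
    integral\<^sup>L lebesgue (\<lambda>y. \<bar>v y\<bar> powr P)
      \<le> (K * (integral\<^sup>L lebesgue (\<lambda>y. \<bar>v y\<bar> powr p) + enn2real (kernel_energy (slog_kernel s p) p v))) powr (P / p)"
    using assms \<open>0 < p\<close>
    by (intro sobolev_inequality[where N = "real CARD('n)" and \<sigma> = "s * p" and c = "slog_const CARD('n) s p" and \<rho> = "exp (-1)"])
       (auto simp: P intro: slog_const_pos slog_kernel_nonneg slog_kernel_ge_power[simplified])
  then obtain K where K: "0 < K" and bound: "\<And>v::real ^ 'n \<Rightarrow> real. v \<in> borel_measurable lebesgue \<Longrightarrow>
    integrable lebesgue (\<lambda>y. \<bar>v y\<bar> powr p) \<Longrightarrow> kernel_energy (slog_kernel s p) p v < \<infinity> \<Longrightarrow>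
    integrable lebesgue (\<lambda>y. \<bar>v y\<bar> powr P) \<and>
    integral\<^sup>L lebesgue (\<lambda>y. \<bar>v y\<bar> powr P)
      \<le> (K * (integral\<^sup>L lebesgue (\<lambda>y. \<bar>v y\<bar> powr p) + enn2real (kernel_energy (slog_kernel s p) p v))) powr (P / p)"
    by blast
  show ?thesis
  proof (intro exI[of _ "max 1 (K powr (1 / p))"] conjI allI impI)
    fix u :: "real ^ 'n \<Rightarrow> real"
    assume u: "u \<in> slog_space s p"
    define A where "A = integral\<^sup>L lebesgue (\<lambda>x. \<bar>u x\<bar> powr p)"
    define e where "e = enn2real (slog_energy s p u)"
    have "0 \<le> A" by (simp add: A_def)
    then have norm_p: "Lp_norm p u powr p = A"
      using \<open>0 < p\<close> by (simp add: Lp_norm_def A_def[symmetric] powr_powr)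
    have um: "u \<in> borel_measurable lebesgue" "integrable lebesgue (\<lambda>y. \<bar>u y\<bar> powr p)"
      "kernel_energy (slog_kernel s p) p u < \<infinity>"
      using u by (auto simp: slog_space_def Lp_space_def slog_energy_eq)
    note b = bound[OF um]
    show "u \<in> Lp_space P" using b um by (simp add: Lp_space_def)
    have "Lp_norm P u \<le> ((K * (A + e)) powr (P / p)) powr (1 / P)"
      unfolding Lp_norm_def A_def e_def slog_energy_eq
      using b \<open>0 < P\<close> by (intro powr_mono2) auto
    also have "\<dots> = K powr (1 / p) * slog_norm s p u"
      using \<open>0 < P\<close> by (simp add: slog_norm_def norm_p e_def powr_powr powr_mult)
    also have "\<dots> \<le> max 1 (K powr (1 / p)) * slog_norm s p u"
      by (intro mult_right_mono) (auto simp: slog_norm_def)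
    finally show "Lp_norm P u \<le> max 1 (K powr (1 / p)) * slog_norm s p u" .
  qed simp
qed

theorem theorem3p6:
  fixes s p q :: real
  assumes "1 < p" and "0 < s" and "s < 1"
    and "s * p < real CARD('n::finite)"
    and "q \<in> {p .. sobolev_exponent CARD('n) s p}"
  shows "(\<exists>!\<theta>. \<theta> \<in> {0..1} \<and>
            1 / q = (1 - \<theta>) / p + \<theta> / sobolev_exponent CARD('n) s p) \<and>
         (\<exists>C>0. \<forall>\<theta>\<in>{0..1}.
            1 / q = (1 - \<theta>) / p + \<theta> / sobolev_exponent CARD('n) s p \<longrightarrow>
            (\<forall>u :: real ^ 'n \<Rightarrow> real. u \<in> slog_space s p \<longrightarrow>
               u \<in> Lp_space q \<and>
               Lp_norm q u \<le> C * slog_norm s p u powr \<theta> * Lp_norm p u powr (1 - \<theta>)))"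
proof (rule conjI)
  let ?P = "sobolev_exponent CARD('n) s p"
  have "0 < s * p" using assms by simp
  then have pP: "p < ?P"
    unfolding sobolev_exponent_def using assms(1,4) by (simp add: less_divide_eq algebra_simps)
  then show "\<exists>!\<theta>. \<theta> \<in> {0..1} \<and> 1 / q = (1 - \<theta>) / p + \<theta> / ?P"
    using assms by (intro interpolation_parameter_unique) auto
  obtain C where C: "1 \<le> C" and embed: "\<And>u :: real ^ 'n \<Rightarrow> real. u \<in> slog_space s p \<Longrightarrow>
      u \<in> Lp_space ?P \<and> Lp_norm ?P u \<le> C * slog_norm s p u"
    using slog_sobolev_embedding[OF assms(1-4)] by blast
  have pos: "0 < p" "0 < ?P" "0 < q" using assms pP by auto
  show "\<exists>C>0. \<forall>\<theta>\<in>{0..1}. 1 / q = (1 - \<theta>) / p + \<theta> / ?P \<longrightarrow>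
          (\<forall>u :: real ^ 'n \<Rightarrow> real. u \<in> slog_space s p \<longrightarrow> u \<in> Lp_space q \<and>
             Lp_norm q u \<le> C * slog_norm s p u powr \<theta> * Lp_norm p u powr (1 - \<theta>))"
  proof (rule exI[of _ C], rule conjI, use C in simp, intro ballI impI allI)
    fix \<theta> and u :: "real ^ 'n \<Rightarrow> real"
    assume \<theta>: "\<theta> \<in> {0..1}" and q: "1 / q = (1 - \<theta>) / p + \<theta> / ?P" and u: "u \<in> slog_space s p"
    have up: "u \<in> Lp_space p" using u by (simp add: slog_space_def)
    from embed[OF u] have uP: "u \<in> Lp_space ?P" and le: "Lp_norm ?P u \<le> C * slog_norm s p u" by auto
    note int = Lp_norm_interpolation[OF up uP pos \<theta> q]
    have "Lp_norm ?P u powr \<theta> \<le> (C * slog_norm s p u) powr \<theta>"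
      using le \<theta> by (intro powr_mono2) (auto simp: Lp_norm_def)
    also have "\<dots> = C powr \<theta> * slog_norm s p u powr \<theta>" by (simp add: powr_mult)
    also have "\<dots> \<le> C powr 1 * slog_norm s p u powr \<theta>"
      using C \<theta> by (intro mult_right_mono powr_mono) auto
    also have "\<dots> = C * slog_norm s p u powr \<theta>" using C by simp
    finally have "Lp_norm p u powr (1 - \<theta>) * Lp_norm ?P u powr \<theta>
        \<le> Lp_norm p u powr (1 - \<theta>) * (C * slog_norm s p u powr \<theta>)"
      by (rule mult_left_mono) simp
    with int show "u \<in> Lp_space q \<and>
        Lp_norm q u \<le> C * slog_norm s p u powr \<theta> * Lp_norm p u powr (1 - \<theta>)"
      by (auto simp: mult_ac)
  qed
qed

end
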